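(* For each $n\ge1$ let $N(n)\in\{1,2,\dots\}\cup\{\infty\}$, and suppose that $\mathbf p_n=\{p_{ni}\}_{i=1}^{N(n)}$ and $\mathbf p_n'=\{p_{ni}'\}_{i=1}^{N(n)}$ are random vectors in $[0,1]^{N(n)}$. Let $X_n=(I_{ni})_{i=1}^{N(n)}$ and $X_n'=(I_{ni}')_{i=1}^{N(n)}$ be random vectors of indicator variables such that, conditionally on $\mathbf p_n$, the variables $I_{ni}$ are independent with $(I_{ni}\mid\mathbf p_n)\sim\mathrm{Be}(p_{ni})$, and, conditionally on $\mathbf p_n'$, the variables $I_{ni}'$ are independent with $(I_{ni}'\mid\mathbf p_n')\sim\mathrm{Be}(p_{ni}')$. Write $q_{ni}:=1-p_{ni}$ and $q_{ni}':=1-p_{ni}'$. (i) If $$\sum_{i=1}^{N(n)}\rho(p_{ni},p_{ni}')=o_p(1),$$ then $X_n\cong X_n'$ (asymptotic equivalence). (ii) If $$\sum_{i=1}^{N(n)}\rho(p_{ni},p_{ni}')=O_p(1)$$ and, for every $\varepsilon>0$, $$\lim_{C\to\infty}\limsup_{n\to\infty}\mathbb P\left(\sum_{i:\,p_{ni}>Cp_{ni}'}p_{ni}+\sum_{i:\,q_{ni}>Cq_{ni}'}q_{ni}>\varepsilon\right)=0,$$ then $X_n\vartriangleleft X_n'$ (contiguity of $(X_n)_n$ with respect to $(X_n')_n$).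
   Context: $\mathrm{Be}(p)$ is the Bernoulli distribution on $\{0,1\}$ with probability $p$ of the value $1$; an indicator variable is a random variable with values in $\{0,1\}$. For each $n$, $\mathbf p_n$ and $\mathbf p_n'$ are defined on a common probability space. For $p,q\in[0,1]$, $$\rho(p,q):=\bigl(\sqrt p-\sqrt q\bigr)^2+\bigl(\sqrt{1-p}-\sqrt{1-q}\bigr)^2 .$$ For nonnegative random quantities $S_n$: $S_n=o_p(1)$ means $S_n\to0$ in probability as $n\to\infty$; $S_n=O_p(1)$ means that for every $\varepsilon>0$ there exists $C$ such that $\mathbb P(S_n>C)<\varepsilon$ for all $n$. The vectors $X_n,X_n'$ take values in $\{0,1\}^{N(n)}$ with the product $\sigma$-field; if $N(n)=\infty$ the index set is $\{1,2,\dots\}$. Let $X_n$ and $Y_n$ ($n\ge1$) be random variables with values in the same measurable space $(\mathcal X_n,\mathcal A_n)$. The sequence $(X_n)_n$ is asymptotically equivalent to $(Y_n)_n$, written $X_n\cong Y_n$, if $\mathbb P(X_n\in A_n)-\mathbb P(Y_n\in A_n)\to0$ as $n\to\infty$ for every sequence of sets $A_n\in\mathcal A_n$. The sequence $(X_n)_n$ is contiguous with respect to $(Y_n)_n$, written $X_n\vartriangleleft Y_n$, if for every sequence of sets $A_n\in\mathcal A_n$ with $\mathbb P(Y_n\in A_n)\to0$ one also has $\mathbb P(X_n\in A_n)\to0$. These notions depend only on the distributions of $X_n$ and $Y_n$. *)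

theory Defs
  imports "HOL-Probability.Probability"
begin

definition rho :: "real \<Rightarrow> real \<Rightarrow> real" where
  "rho p q = (sqrt p - sqrt q)\<^sup>2 + (sqrt (1 - p) - sqrt (1 - q))\<^sup>2"

(* {1, ..., N} for finite N, and {1, 2, ...} for N = \<infinity>. *)
definition idx :: "enat \<Rightarrow> nat set" where
  "idx N = {i. 1 \<le> i \<and> enat i \<le> N}"

(* Indicators are bool-valued, with False = 0 and True = 1, so that Be(p) is bernoulli_pmf p. *)
abbreviation unit_cube :: "enat \<Rightarrow> (nat \<Rightarrow> real) measure" where
  "unit_cube N \<equiv> PiM (idx N) (\<lambda>_. restrict_space borel {0..1})"

abbreviation binary_cube :: "enat \<Rightarrow> (nat \<Rightarrow> bool) measure" where
  "binary_cube N \<equiv> PiM (idx N) (\<lambda>_. count_space UNIV)"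

(* The conditional probability P(X \<in> B | F), defined up to almost sure equality. *)
definition cprob :: "'a measure \<Rightarrow> 'a measure \<Rightarrow> ('a \<Rightarrow> 'b) \<Rightarrow> 'b set \<Rightarrow> 'a \<Rightarrow> real" where
  "cprob M F X B = real_cond_exp M F (indicator (X -` B \<inter> space M))"

definition cond_indep_vars ::
  "'a measure \<Rightarrow> 'a measure \<Rightarrow> ('i \<Rightarrow> 'b measure) \<Rightarrow> ('i \<Rightarrow> 'a \<Rightarrow> 'b) \<Rightarrow> 'i set \<Rightarrow> bool" where
  "cond_indep_vars M F S X I \<longleftrightarrow>
     (\<forall>i\<in>I. X i \<in> measurable M (S i)) \<and>
     (\<forall>J\<subseteq>I. J \<noteq> {} \<longrightarrow> finite J \<longrightarrow> (\<forall>B\<in>(\<Pi> j\<in>J. sets (S j)).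
        AE \<omega> in M. real_cond_exp M F (indicator (\<Inter>j\<in>J. X j -` B j \<inter> space M)) \<omega>
                   = (\<Prod>j\<in>J. cprob M F (X j) (B j) \<omega>)))"

(* (X | F) ~ K, where K is a random probability measure. *)
definition has_cond_distr ::
  "'a measure \<Rightarrow> 'a measure \<Rightarrow> 'b measure \<Rightarrow> ('a \<Rightarrow> 'b) \<Rightarrow> ('a \<Rightarrow> 'b measure) \<Rightarrow> bool" where
  "has_cond_distr M F S X K \<longleftrightarrow>
     X \<in> measurable M S \<and>
     (\<forall>B\<in>sets S. AE \<omega> in M. cprob M F X B \<omega> = measure (K \<omega>) B)"

(* Conditioning on the random vector p means conditioning on the sigma-field it generates. *)
definition cond_bernoulli_vector ::
  "'a measure \<Rightarrow> enat \<Rightarrow> ('a \<Rightarrow> nat \<Rightarrow> real) \<Rightarrow> ('a \<Rightarrow> nat \<Rightarrow> bool) \<Rightarrow> bool" where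
  "cond_bernoulli_vector M N p X \<longleftrightarrow>
     (let F = vimage_algebra (space M) p (unit_cube N) in
       cond_indep_vars M F (\<lambda>_. count_space UNIV) (\<lambda>i \<omega>. X \<omega> i) (idx N) \<and>
       (\<forall>i\<in>idx N. has_cond_distr M F (count_space UNIV) (\<lambda>\<omega>. X \<omega> i)
                     (\<lambda>\<omega>. measure_pmf (bernoulli_pmf (p \<omega> i)))))"

(* Sequences are indexed by n \<ge> 1; the term with n = 0 is ignored throughout. The random
   quantities are ennreal-valued since infinite sums may diverge. *)
definition small_o_p_1 :: "(nat \<Rightarrow> 'a measure) \<Rightarrow> (nat \<Rightarrow> 'a \<Rightarrow> ennreal) \<Rightarrow> bool" where
  "small_o_p_1 M S \<longleftrightarrow>
     (\<forall>\<epsilon>::real. \<epsilon> > 0 \<longrightarrow>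
        (\<lambda>n. measure (M n) {\<omega>\<in>space (M n). S n \<omega> > ennreal \<epsilon>}) \<longlonglongrightarrow> 0)"

definition big_O_p_1 :: "(nat \<Rightarrow> 'a measure) \<Rightarrow> (nat \<Rightarrow> 'a \<Rightarrow> ennreal) \<Rightarrow> bool" where
  "big_O_p_1 M S \<longleftrightarrow>
     (\<forall>\<epsilon>::real. \<epsilon> > 0 \<longrightarrow>
        (\<exists>C::real. \<forall>n\<ge>1. measure (M n) {\<omega>\<in>space (M n). S n \<omega> > ennreal C} < \<epsilon>))"

(* X n and Y n may live on different probability spaces L n and M n; they take values in the
   same measurable space S n. *)
definition asymp_equivalent ::
  "(nat \<Rightarrow> 'c measure) \<Rightarrow> (nat \<Rightarrow> 'a measure) \<Rightarrow> (nat \<Rightarrow> 'a \<Rightarrow> 'c) \<Rightarrow>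
   (nat \<Rightarrow> 'b measure) \<Rightarrow> (nat \<Rightarrow> 'b \<Rightarrow> 'c) \<Rightarrow> bool" where
  "asymp_equivalent S L X M Y \<longleftrightarrow>
     (\<forall>A. (\<forall>n\<ge>1. A n \<in> sets (S n)) \<longrightarrow>
        (\<lambda>n. measure (L n) {\<omega>\<in>space (L n). X n \<omega> \<in> A n}
           - measure (M n) {\<omega>\<in>space (M n). Y n \<omega> \<in> A n}) \<longlonglongrightarrow> 0)"

definition contiguous_wrt ::
  "(nat \<Rightarrow> 'c measure) \<Rightarrow> (nat \<Rightarrow> 'a measure) \<Rightarrow> (nat \<Rightarrow> 'a \<Rightarrow> 'c) \<Rightarrow>
   (nat \<Rightarrow> 'b measure) \<Rightarrow> (nat \<Rightarrow> 'b \<Rightarrow> 'c) \<Rightarrow> bool" where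
  "contiguous_wrt S L X M Y \<longleftrightarrow>
     (\<forall>A. (\<forall>n\<ge>1. A n \<in> sets (S n)) \<longrightarrow>
        (\<lambda>n. measure (M n) {\<omega>\<in>space (M n). Y n \<omega> \<in> A n}) \<longlonglongrightarrow> 0 \<longrightarrow>
        (\<lambda>n. measure (L n) {\<omega>\<in>space (L n). X n \<omega> \<in> A n}) \<longlonglongrightarrow> 0)"

end

theory Submission
  imports Defs
begin

text \<open>
Conditionally on the probability vectors, all finite-dimensional marginals are products of Bernoulli
laws, and a set in the product \<open>\<sigma>\<close>-field is approximated by cylinders simultaneously under the laws
of \<open>X\<close> and \<open>X'\<close>. It therefore suffices to compare two finite products \<open>\<mu>\<close> and \<open>\<nu>\<close> by linear bounds
\<open>\<mu>(B) \<le> a + b \<nu>(B)\<close> that hold on an event of large probability, uniformly in \<open>B\<close> and the dimension: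
such a bound survives both integration over the parameters and the cylinder approximation. For (i),
the Hellinger distance gives it with \<open>b = 1\<close> and \<open>a\<close> small. For (ii), one discards the outcomes in which
some coordinate has likelihood ratio above \<open>C\<close>. On the remaining outcomes the \<open>\<mu>\<close>-integral of the
likelihood ratio \<open>d\<mu>/d\<nu>\<close> is at most \<open>exp ((1 + \<surd>C)\<^sup>2 \<Sum> \<rho>)\<close>, since it is a product over the
coordinates, and AM-GM turns this into a linear bound.
\<close>

section \<open>Finite products of Bernoulli laws\<close>

definition bern_wt :: "real \<Rightarrow> bool \<Rightarrow> real" where
  "bern_wt u b = (if b then u else 1 - u)"

text \<open>This is the probability of \<open>B\<close> under the product of the laws
  Be(\<open>f j\<close>), \<open>j\<close> in \<open>J\<close>. Intersecting with the extensional
  functions lets \<open>B\<close> be an arbitrary set of functions, such as \<open>UNIV\<close> or a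
  complement.\<close>

definition bern_mass :: "('i \<Rightarrow> real) \<Rightarrow> 'i set \<Rightarrow> ('i \<Rightarrow> bool) set \<Rightarrow> real" where
  "bern_mass f J B = (\<Sum>x\<in>B \<inter> (\<Pi>\<^sub>E j\<in>J. UNIV). \<Prod>j\<in>J. bern_wt (f j) (x j))"

lemma bern_wt_nonneg: "u \<in> {0..1} \<Longrightarrow> 0 \<le> bern_wt u b"
  by (auto simp: bern_wt_def)

lemma sum_bern_wt: "(\<Sum>b\<in>UNIV. bern_wt u b) = 1"
  by (simp add: bern_wt_def UNIV_bool)

lemma bern_mass_PiE:
  assumes "finite J"
  shows "bern_mass f J (\<Pi>\<^sub>E j\<in>J. G j) = (\<Prod>j\<in>J. \<Sum>b\<in>G j. bern_wt (f j) b)"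
proof -
  have "(\<Pi>\<^sub>E j\<in>J. G j) \<inter> (\<Pi>\<^sub>E j\<in>J. UNIV) = (\<Pi>\<^sub>E j\<in>J. G j)"
    by (auto simp: PiE_def)
  then show ?thesis
    unfolding bern_mass_def using assms by (simp add: prod_sum_PiE)
qed

lemma bern_mass_UNIV: "finite J \<Longrightarrow> bern_mass f J UNIV = 1"
  using bern_mass_PiE[of J f "\<lambda>_. UNIV"] by (simp add: bern_mass_def sum_bern_wt)

lemma finite_PiE_bool: "finite J \<Longrightarrow> finite (\<Pi>\<^sub>E j\<in>J. (UNIV :: bool set))"
  by (rule finite_PiE) auto

lemma bern_mass_bounds:
  assumes "finite J" "\<And>j. j \<in> J \<Longrightarrow> f j \<in> {0..1}"
  shows "0 \<le> bern_mass f J B" "bern_mass f J B \<le> 1"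
proof -
  have nn: "0 \<le> (\<Prod>j\<in>J. bern_wt (f j) (x j))" for x
    using assms by (intro prod_nonneg bern_wt_nonneg) auto
  show "0 \<le> bern_mass f J B"
    unfolding bern_mass_def by (intro sum_nonneg nn)
  have "bern_mass f J B \<le> bern_mass f J UNIV"
    unfolding bern_mass_def using assms by (intro sum_mono2) (auto intro: nn finite_PiE_bool)
  then show "bern_mass f J B \<le> 1"
    using bern_mass_UNIV[OF assms(1)] by simp
qed

section \<open>Hellinger distance of finite products, for (i)\<close>

lemma rho_commute: "rho u v = rho v u"
  by (simp add: rho_def power2_commute)

lemma rho_nonneg: "0 \<le> rho u v"
  by (simp add: rho_def)

text \<open>The left side is the Hellinger affinity of Be(\<open>u\<close>) and
  Be(\<open>v\<close>). Expanding the squares in \<open>rho\<close> gives 2 minus twice this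
  affinity.\<close>

lemma sum_sqrt_bern_wt:
  assumes "u \<in> {0..1}" "v \<in> {0..1}"
  shows "(\<Sum>b\<in>UNIV. sqrt (bern_wt u b) * sqrt (bern_wt v b)) = 1 - rho u v / 2"
  using assms by (simp add: bern_wt_def UNIV_bool rho_def power2_diff field_simps)

lemma sqrt_prod: "sqrt (prod f A) = (\<Prod>x\<in>A. sqrt (f x))"
  by (induction A rule: infinite_finite_induct) (auto simp: real_sqrt_mult)

text \<open>The affinity is multiplicative over independent coordinates, so the squared Hellinger
  distance of the products equals 2 - 2 times the product of the factors 1 - \<open>rho\<close>/2.
  The Weierstrass product inequality then bounds it by the sum of the \<open>rho\<close>
  terms.\<close>

lemma sum_hellinger_le:
  assumes J: "finite J" and f: "\<And>j. j \<in> J \<Longrightarrow> f j \<in> {0..1}" and g: "\<And>j. j \<in> J \<Longrightarrow> g j \<in> {0..1}"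
  shows "(\<Sum>x\<in>(\<Pi>\<^sub>E j\<in>J. UNIV). (sqrt (\<Prod>j\<in>J. bern_wt (f j) (x j)) - sqrt (\<Prod>j\<in>J. bern_wt (g j) (x j)))\<^sup>2)
           \<le> (\<Sum>j\<in>J. rho (f j) (g j))"
proof -
  let ?E = "\<Pi>\<^sub>E j\<in>J. (UNIV::bool set)"
  let ?m = "\<lambda>f x. \<Prod>j\<in>J. bern_wt (f j) (x j)"
  have nn: "0 \<le> ?m f x" "0 \<le> ?m g x" for x
    using f g by (auto intro!: prod_nonneg bern_wt_nonneg)
  have tot: "(\<Sum>x\<in>?E. ?m h x) = 1" for h
    using bern_mass_UNIV[OF J, of h] by (simp add: bern_mass_def)
  \<comment> \<open>The Weierstrass inequality needs \<open>rho\<close>/2 to be at most 1; this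
    holds because an affinity is a sum of nonnegative terms.\<close>
  have aff: "1 - rho (f j) (g j) / 2 \<ge> 0" if "j \<in> J" for j
    unfolding sum_sqrt_bern_wt[OF f[OF that] g[OF that], symmetric]
    using f[OF that] g[OF that] by (intro sum_nonneg mult_nonneg_nonneg) (auto intro: bern_wt_nonneg)
  have "(\<Sum>x\<in>?E. (sqrt (?m f x) - sqrt (?m g x))\<^sup>2)
      = (\<Sum>x\<in>?E. ?m f x + ?m g x - 2 * (\<Prod>j\<in>J. sqrt (bern_wt (f j) (x j)) * sqrt (bern_wt (g j) (x j))))"
  proof (intro sum.cong refl)
    fix x
    have "sqrt (?m f x) * sqrt (?m g x) = (\<Prod>j\<in>J. sqrt (bern_wt (f j) (x j)) * sqrt (bern_wt (g j) (x j)))"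
      by (simp add: sqrt_prod prod.distrib)
    then show "(sqrt (?m f x) - sqrt (?m g x))\<^sup>2
        = ?m f x + ?m g x - 2 * (\<Prod>j\<in>J. sqrt (bern_wt (f j) (x j)) * sqrt (bern_wt (g j) (x j)))"
      using nn[of x] by (simp only: power2_diff real_sqrt_pow2 mult.assoc)
  qed
  also have "\<dots> = 2 - 2 * (\<Sum>x\<in>?E. \<Prod>j\<in>J. sqrt (bern_wt (f j) (x j)) * sqrt (bern_wt (g j) (x j)))"
    by (simp add: sum_subtractf sum.distrib tot sum_distrib_left)
  also have "(\<Sum>x\<in>?E. \<Prod>j\<in>J. sqrt (bern_wt (f j) (x j)) * sqrt (bern_wt (g j) (x j)))
      = (\<Prod>j\<in>J. \<Sum>b\<in>UNIV. sqrt (bern_wt (f j) b) * sqrt (bern_wt (g j) b))"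
    using J by (simp add: prod_sum_PiE)
  also have "\<dots> = (\<Prod>j\<in>J. 1 - rho (f j) (g j) / 2)"
    using f g by (intro prod.cong refl sum_sqrt_bern_wt)
  finally have "(\<Sum>x\<in>?E. (sqrt (?m f x) - sqrt (?m g x))\<^sup>2) = 2 - 2 * (\<Prod>j\<in>J. 1 - rho (f j) (g j) / 2)" .
  moreover have "1 - (\<Sum>j\<in>J. rho (f j) (g j) / 2) \<le> (\<Prod>j\<in>J. 1 - rho (f j) (g j) / 2)"
    using aff by (intro Weierstrass_prod_ineq) (auto simp: rho_nonneg)
  ultimately show ?thesis by (simp add: sum_divide_distrib[symmetric])
qed

text \<open>The point is the coefficient 1 of \<open>bern_mass g J B\<close> and an error free of
  \<open>B\<close>. The parameter \<open>t\<close> stays open so that it can later be balanced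
  against the sum of \<open>rho\<close>.\<close>

lemma bern_mass_le_hellinger:
  assumes J: "finite J" and f: "\<And>j. j \<in> J \<Longrightarrow> f j \<in> {0..1}" and g: "\<And>j. j \<in> J \<Longrightarrow> g j \<in> {0..1}"
    and t: "t > 0"
  shows "bern_mass f J B \<le> bern_mass g J B + (\<Sum>j\<in>J. rho (f j) (g j)) / (2 * t) + 2 * t"
proof -
  let ?E = "\<Pi>\<^sub>E j\<in>J. (UNIV::bool set)"
  let ?m = "\<lambda>f x. \<Prod>j\<in>J. bern_wt (f j) (x j)"
  let ?d = "\<lambda>x. (sqrt (?m f x) - sqrt (?m g x))\<^sup>2 / (2 * t) + t * (?m f x + ?m g x)"
  have nn: "0 \<le> ?m f x" "0 \<le> ?m g x" for x
    using f g by (auto intro!: prod_nonneg bern_wt_nonneg)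
  have tot: "(\<Sum>x\<in>?E. ?m h x) = 1" for h
    using bern_mass_UNIV[OF J, of h] by (simp add: bern_mass_def)
  \<comment> \<open>With \<open>\<mu> - \<nu> = (\<surd>\<mu> - \<surd>\<nu>) (\<surd>\<mu> + \<surd>\<nu>)\<close>, AM-GM separates the two factors.\<close>
  have amgm: "a\<^sup>2 - b\<^sup>2 \<le> (a - b)\<^sup>2 / (2 * t) + t * (a\<^sup>2 + b\<^sup>2)" for a b :: real
  proof -
    \<comment> \<open>The extra term t (a - b)^2 / 2 completes t (a + b)^2 / 2 to t (a^2 +
      b^2).\<close>
    have "0 \<le> ((a - b) - t * (a + b))\<^sup>2 / (2 * t) + t * (a - b)\<^sup>2 / 2" using t by simp
    also have "\<dots> = (a - b)\<^sup>2 / (2 * t) + t * (a\<^sup>2 + b\<^sup>2) - (a\<^sup>2 - b\<^sup>2)"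
      using t by (simp add: field_simps power2_eq_square)
    finally show ?thesis by simp
  qed
  have d: "?m f x - ?m g x \<le> ?d x" for x
    using amgm[of "sqrt (?m f x)" "sqrt (?m g x)"] nn by simp
  have "bern_mass f J B - bern_mass g J B = (\<Sum>x\<in>B \<inter> ?E. ?m f x - ?m g x)"
    by (simp add: bern_mass_def sum_subtractf)
  also have "\<dots> \<le> (\<Sum>x\<in>B \<inter> ?E. ?d x)"
    by (intro sum_mono d)
  \<comment> \<open>Every \<open>?d x\<close> is nonnegative, so the sum may be enlarged to all
    outcomes; this removes \<open>B\<close> from the error.\<close>
  also have "\<dots> \<le> (\<Sum>x\<in>?E. ?d x)"
    using J nn t by (intro sum_mono2 finite_PiE_bool) (auto intro!: add_nonneg_nonneg)
  also have "\<dots> = (\<Sum>x\<in>?E. (sqrt (?m f x) - sqrt (?m g x))\<^sup>2) / (2 * t) + 2 * t"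
    by (simp add: sum.distrib sum_divide_distrib tot flip: sum_distrib_left)
  also have "\<dots> \<le> (\<Sum>j\<in>J. rho (f j) (g j)) / (2 * t) + 2 * t"
    using sum_hellinger_le[OF J f g] t by (simp add: divide_right_mono)
  finally show ?thesis by simp
qed

section \<open>Truncated second moment of the likelihood ratio, for (ii)\<close>

text \<open>Expanding the square of a = b + (a - b) gives a^2 / b = 2 a - b + (a - b)^2 / b, and (a
  - b)^2 is the product of the squares of sqrt a + sqrt b and sqrt a - sqrt b. The ratio bound
  controls the first of these by (1 + sqrt C)^2 b. The part 2 a - b is kept because it sums to 1
  over the two outcomes of a Bernoulli variable.\<close>

lemma sq_div_le_sqrt_diff:
  fixes a b C :: real
  assumes "a \<ge> 0" "b \<ge> 0" "C \<ge> 1" "a \<le> C * b"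
  shows "a\<^sup>2 / b \<le> 2 * a - b + (1 + sqrt C)\<^sup>2 * (sqrt a - sqrt b)\<^sup>2"
proof (cases "b = 0")
  \<comment> \<open>Here \<open>a\<close> is 0 as well, and division by zero yields 0.\<close>
  case True
  then show ?thesis using assms by simp
next
  case False
  then have b: "b > 0" using assms by simp
  have "sqrt a \<le> sqrt C * sqrt b"
    using assms(4) by (metis real_sqrt_le_mono real_sqrt_mult)
  then have "(sqrt a + sqrt b)\<^sup>2 \<le> ((1 + sqrt C) * sqrt b)\<^sup>2"
    using assms by (intro power_mono) (auto simp: algebra_simps)
  also have "\<dots> = (1 + sqrt C)\<^sup>2 * b"
    using b by (simp add: power_mult_distrib)
  finally have "(sqrt a + sqrt b)\<^sup>2 * (sqrt a - sqrt b)\<^sup>2 \<le> (1 + sqrt C)\<^sup>2 * b * (sqrt a - sqrt b)\<^sup>2"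
    by (intro mult_right_mono) auto
  moreover have "(sqrt a + sqrt b) * (sqrt a - sqrt b) = a - b"
    using assms by (simp add: algebra_simps)
  ultimately have "(a - b)\<^sup>2 \<le> (1 + sqrt C)\<^sup>2 * b * (sqrt a - sqrt b)\<^sup>2"
    by (metis power_mult_distrib)
  then have "(a - b)\<^sup>2 / b \<le> (1 + sqrt C)\<^sup>2 * (sqrt a - sqrt b)\<^sup>2"
    using b by (simp add: field_simps)
  moreover have "a\<^sup>2 / b = 2 * a - b + (a - b)\<^sup>2 / b"
    using b by (simp add: field_simps power2_eq_square)
  ultimately show ?thesis by simp
qed

text \<open>If both outcomes have ratio at most \<open>C\<close>, the previous estimate is summed
  over them. If exactly one does, then Be(\<open>u\<close>) gives at least as much mass as
  Be(\<open>v\<close>) to the other outcome, because \<open>C\<close> is at least 1. Hence it gives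
  at most as much mass to the remaining one, whose term is then at most 1.\<close>

lemma sum_good_sq_div_le:
  assumes u: "u \<in> {0..1}" and v: "v \<in> {0..1}" and C: "C \<ge> 1"
  shows "(\<Sum>b\<in>{b. bern_wt u b \<le> C * bern_wt v b}. (bern_wt u b)\<^sup>2 / bern_wt v b)
           \<le> 1 + (1 + sqrt C)\<^sup>2 * rho u v"
proof -
  let ?G = "{b. bern_wt u b \<le> C * bern_wt v b}"
  have one: "x\<^sup>2 / y \<le> 1" if "0 \<le> x" "x \<le> y" "y \<le> 1" for x y :: real
  proof (cases "y = 0")
    case False
    have "x\<^sup>2 \<le> y * 1" using that unfolding power2_eq_square by (intro mult_mono) auto
    then show ?thesis using that False by (simp add: field_simps)
  qed auto
  have ge1: "1 \<le> 1 + (1 + sqrt C)\<^sup>2 * rho u v"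
    by (simp add: rho_nonneg)
  have Cge: "C * x \<ge> x" if "x \<ge> 0" for x
    using mult_right_mono[OF C that] by simp
  consider "?G = UNIV" | "?G = {}" | b where "?G = {b}" "bern_wt u (\<not> b) > C * bern_wt v (\<not> b)"
    by (cases "True \<in> ?G"; cases "False \<in> ?G") (force simp: set_eq_iff all_bool_eq)+
  then show ?thesis
  proof cases
    case 1
    then have *: "bern_wt u b \<le> C * bern_wt v b" for b by auto
    have "(\<Sum>b\<in>?G. (bern_wt u b)\<^sup>2 / bern_wt v b)
        \<le> (\<Sum>b\<in>UNIV. 2 * bern_wt u b - bern_wt v b + (1 + sqrt C)\<^sup>2 * (sqrt (bern_wt u b) - sqrt (bern_wt v b))\<^sup>2)"
      unfolding 1 using u v C * by (intro sum_mono sq_div_le_sqrt_diff bern_wt_nonneg)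
    also have "\<dots> = 1 + (1 + sqrt C)\<^sup>2 * rho u v"
      by (simp add: UNIV_bool bern_wt_def rho_def algebra_simps)
    finally show ?thesis .
  next
    case 2
    show ?thesis unfolding 2 using ge1 by simp
  next
    case (3 b)
    have "bern_wt v (\<not> b) \<le> bern_wt u (\<not> b)"
      using Cge[of "bern_wt v (\<not> b)"] bern_wt_nonneg[OF v, of "\<not> b"] 3(2) by linarith
    then have "bern_wt u b \<le> bern_wt v b"
      by (auto simp: bern_wt_def split: if_splits)
    then have "(bern_wt u b)\<^sup>2 / bern_wt v b \<le> 1"
      using u v by (intro one) (auto simp: bern_wt_def)
    with ge1 3(1) show ?thesis by simp
  qed
qed

text \<open>Outcomes with some coordinate of ratio above \<open>C\<close> are paid for by a union
  bound. On the rest, AM-GM with weight \<open>t\<close> trades the mass under \<open>f\<close> for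
  a second moment of the likelihood ratio and the mass under \<open>g\<close>. A small
  \<open>t\<close> makes the second-moment term small at the price of a large but fixed factor 1/(2
  t).\<close>

lemma bern_mass_le_tail:
  assumes J: "finite J" and f: "\<And>j. j \<in> J \<Longrightarrow> f j \<in> {0..1}" and g: "\<And>j. j \<in> J \<Longrightarrow> g j \<in> {0..1}"
    and C: "C \<ge> 1" and t: "t > 0"
  shows "bern_mass f J B \<le> (\<Sum>j\<in>J. \<Sum>b\<in>{b. bern_wt (f j) b > C * bern_wt (g j) b}. bern_wt (f j) b)
           + (t * exp ((1 + sqrt C)\<^sup>2 * (\<Sum>j\<in>J. rho (f j) (g j))) + bern_mass g J B / t) / 2"
proof -
  let ?E = "\<Pi>\<^sub>E j\<in>J. (UNIV::bool set)"
  let ?m = "\<lambda>f x. \<Prod>j\<in>J. bern_wt (f j) (x j)"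
  define good where "good j = {b. bern_wt (f j) b \<le> C * bern_wt (g j) b}" for j
  define bad where "bad j = {b. bern_wt (f j) b > C * bern_wt (g j) b}" for j
  define GE where "GE = Pi\<^sub>E J good"
  have GE: "GE \<subseteq> ?E" unfolding GE_def by (auto simp: PiE_def)
  have fin: "finite ?E" using J by (rule finite_PiE_bool)
  have nn: "0 \<le> ?m f x" "0 \<le> ?m g x" for x
    using f g by (auto intro!: prod_nonneg bern_wt_nonneg)
  have split: "(\<Sum>b\<in>good j. bern_wt (f j) b) = 1 - (\<Sum>b\<in>bad j. bern_wt (f j) b)" for j
  proof -
    have "(\<Sum>b\<in>good j. bern_wt (f j) b) + (\<Sum>b\<in>bad j. bern_wt (f j) b) = (\<Sum>b\<in>good j \<union> bad j. bern_wt (f j) b)"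
      by (subst sum.union_disjoint) (auto simp: good_def bad_def)
    also have "good j \<union> bad j = UNIV" by (auto simp: good_def bad_def)
    finally show ?thesis by (simp add: sum_bern_wt)
  qed
  have "bern_mass f J B \<le> bern_mass f J (- GE) + bern_mass f J (B \<inter> GE)"
  proof -
    have "bern_mass f J B \<le> (\<Sum>x\<in>(- GE \<inter> ?E) \<union> (B \<inter> GE \<inter> ?E). ?m f x)"
      unfolding bern_mass_def using fin nn by (intro sum_mono2) auto
    also have "\<dots> = bern_mass f J (- GE) + bern_mass f J (B \<inter> GE)"
      unfolding bern_mass_def using fin by (subst sum.union_disjoint) auto
    finally show ?thesis .
  qed
  also have "bern_mass f J (- GE) \<le> (\<Sum>j\<in>J. \<Sum>b\<in>bad j. bern_wt (f j) b)"
  proof -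
    have "bern_mass f J (- GE) + bern_mass f J GE = (\<Sum>x\<in>(- GE \<inter> ?E) \<union> (GE \<inter> ?E). ?m f x)"
      unfolding bern_mass_def using fin by (subst sum.union_disjoint) auto
    also have "(- GE \<inter> ?E) \<union> (GE \<inter> ?E) = UNIV \<inter> ?E" by auto
    also have "(\<Sum>x\<in>UNIV \<inter> ?E. ?m f x) = 1"
      using bern_mass_UNIV[OF J] by (simp add: bern_mass_def)
    finally have "bern_mass f J (- GE) = 1 - (\<Prod>j\<in>J. 1 - (\<Sum>b\<in>bad j. bern_wt (f j) b))"
      using bern_mass_PiE[OF J, of f good] unfolding split GE_def by simp
    \<comment> \<open>The Weierstrass inequality acts here as the union bound over the coordinates
      that fall into \<open>bad j\<close>.\<close>
    moreover have "1 - (\<Sum>j\<in>J. \<Sum>b\<in>bad j. bern_wt (f j) b) \<le> (\<Prod>j\<in>J. 1 - (\<Sum>b\<in>bad j. bern_wt (f j) b))"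
    proof (rule Weierstrass_prod_ineq)
      fix j assume j: "j \<in> J"
      have "0 \<le> (\<Sum>b\<in>good j. bern_wt (f j) b)" "0 \<le> (\<Sum>b\<in>bad j. bern_wt (f j) b)"
        using f[OF j] by (auto intro!: sum_nonneg bern_wt_nonneg)
      then show "(\<Sum>b\<in>bad j. bern_wt (f j) b) \<in> {0..1}" unfolding split by simp
    qed
    ultimately show ?thesis by simp
  qed
  also have "bern_mass f J (B \<inter> GE)
      \<le> (t * exp ((1 + sqrt C)\<^sup>2 * (\<Sum>j\<in>J. rho (f j) (g j))) + bern_mass g J B / t) / 2"
  proof -
    have amgm: "?m f x \<le> (t * ((?m f x)\<^sup>2 / ?m g x) + ?m g x / t) / 2" if x: "x \<in> GE" for x
    proof (cases "?m g x = 0")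
      \<comment> \<open>On \<open>GE\<close> the law with parameters \<open>f\<close> is absolutely
        continuous with respect to that with parameters \<open>g\<close>: a vanishing factor for
        \<open>g\<close> forces the same factor for \<open>f\<close> to vanish.\<close>
      case True
      then obtain j where j: "j \<in> J" "bern_wt (g j) (x j) = 0" using J by auto
      moreover have "x j \<in> good j" using x j unfolding GE_def by auto
      ultimately have "bern_wt (f j) (x j) = 0"
        using bern_wt_nonneg[OF f[OF j(1)], of "x j"] by (simp add: good_def)
      then have "?m f x = 0" using j J by auto
      with True show ?thesis by simp
    next
      case False
      then have pos: "?m g x > 0" using nn(2)[of x] by linarith
      have "0 \<le> (t * a - b)\<^sup>2 / (2 * t * b)" if "b > 0" for a b :: real using t that by simp
      moreover have "(t * a - b)\<^sup>2 / (2 * t * b) = (t * (a\<^sup>2 / b) + b / t) / 2 - a" if "b > 0" for a b :: real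
        using t that by (simp add: field_simps power2_eq_square)
      ultimately show ?thesis using pos by force
    qed
    have "bern_mass f J (B \<inter> GE) \<le> (\<Sum>x\<in>B \<inter> GE. (t * ((?m f x)\<^sup>2 / ?m g x) + ?m g x / t) / 2)"
    proof -
      have "B \<inter> GE \<inter> ?E = B \<inter> GE" using GE by auto
      then show ?thesis unfolding bern_mass_def by (simp only:) (intro sum_mono amgm, simp)
    qed
    also have "\<dots> = (t * (\<Sum>x\<in>B \<inter> GE. (?m f x)\<^sup>2 / ?m g x) + (\<Sum>x\<in>B \<inter> GE. ?m g x) / t) / 2"
      by (simp add: sum.distrib sum_distrib_left flip: sum_divide_distrib)
    also have "\<dots> \<le> (t * exp ((1 + sqrt C)\<^sup>2 * (\<Sum>j\<in>J. rho (f j) (g j))) + bern_mass g J B / t) / 2"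
    proof -
      have "(\<Sum>x\<in>B \<inter> GE. ?m g x) \<le> bern_mass g J B"
        unfolding bern_mass_def using fin nn GE by (intro sum_mono2) auto
      moreover have "(\<Sum>x\<in>B \<inter> GE. (?m f x)\<^sup>2 / ?m g x) \<le> exp ((1 + sqrt C)\<^sup>2 * (\<Sum>j\<in>J. rho (f j) (g j)))"
      proof -
        have "(\<Sum>x\<in>B \<inter> GE. (?m f x)\<^sup>2 / ?m g x) \<le> (\<Sum>x\<in>GE. (?m f x)\<^sup>2 / ?m g x)"
          using finite_subset[OF GE fin] nn by (intro sum_mono2) auto
        also have "\<dots> = (\<Sum>x\<in>GE. \<Prod>j\<in>J. (bern_wt (f j) (x j))\<^sup>2 / bern_wt (g j) (x j))"
          by (simp add: prod_dividef prod_power_distrib)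
        \<comment> \<open>\<open>GE\<close> is a product set, so the truncated second moment
          factorises over the coordinates.\<close>
        also have "\<dots> = (\<Prod>j\<in>J. \<Sum>b\<in>good j. (bern_wt (f j) b)\<^sup>2 / bern_wt (g j) b)"
          unfolding GE_def using J by (simp add: prod_sum_PiE)
        also have "\<dots> \<le> (\<Prod>j\<in>J. exp ((1 + sqrt C)\<^sup>2 * rho (f j) (g j)))"
        proof (intro prod_mono conjI)
          fix j assume j: "j \<in> J"
          show "0 \<le> (\<Sum>b\<in>good j. (bern_wt (f j) b)\<^sup>2 / bern_wt (g j) b)"
            using g[OF j] by (auto intro!: sum_nonneg divide_nonneg_nonneg bern_wt_nonneg)
          show "(\<Sum>b\<in>good j. (bern_wt (f j) b)\<^sup>2 / bern_wt (g j) b) \<le> exp ((1 + sqrt C)\<^sup>2 * rho (f j) (g j))"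
            using sum_good_sq_div_le[OF f[OF j] g[OF j] C] exp_ge_add_one_self[of "(1 + sqrt C)\<^sup>2 * rho (f j) (g j)"]
            unfolding good_def by linarith
        qed
        also have "\<dots> = exp ((1 + sqrt C)\<^sup>2 * (\<Sum>j\<in>J. rho (f j) (g j)))"
          using J by (simp add: exp_sum sum_distrib_left)
        finally show ?thesis .
      qed
      ultimately show ?thesis using t by (intro divide_right_mono add_mono mult_left_mono) auto
    qed
    finally show ?thesis .
  qed
  finally show ?thesis unfolding bad_def by simp
qed

section \<open>Approximation by cylinders\<close>

text \<open>Over a countable value type a finite product of discrete spaces is discrete, so an
  arbitrary base \<open>B\<close> gives a measurable cylinder.\<close>

lemma cylinder_in_sets_PiM:
  fixes B :: "('i \<Rightarrow> 'b::countable) set"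
  assumes "finite J" "J \<subseteq> I"
  shows "{f \<in> (\<Pi>\<^sub>E i\<in>I. UNIV). restrict f J \<in> B} \<in> sets (PiM I (\<lambda>_. count_space UNIV))"
proof -
  let ?P = "\<lambda>I. PiM I (\<lambda>_. count_space (UNIV :: 'b set))"
  have "(\<lambda>f. restrict f J) \<in> measurable (?P I) (?P J)"
    using assms(2) by (rule measurable_restrict_subset)
  also have "?P J = count_space (\<Pi>\<^sub>E j\<in>J. UNIV)"
    using assms(1) by (rule count_space_PiM_finite) auto
  finally have "(\<lambda>f. restrict f J) -` (B \<inter> (\<Pi>\<^sub>E j\<in>J. UNIV)) \<inter> space (?P I) \<in> sets (?P I)"
    by (rule measurable_sets) auto
  also have "(\<lambda>f. restrict f J) -` (B \<inter> (\<Pi>\<^sub>E j\<in>J. UNIV)) \<inter> space (?P I)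
      = {f \<in> (\<Pi>\<^sub>E i\<in>I. UNIV). restrict f J \<in> B}"
    by (auto simp: space_PiM)
  finally show ?thesis .
qed

text \<open>The sets that cylinders approximate to every accuracy form a sigma-algebra containing
  the generators. Treating a finite set of measures at once makes one cylinder serve for the laws of
  both \<open>X\<close> and \<open>X'\<close>.\<close>

lemma PiM_count_space_approx:
  fixes K :: "('i \<Rightarrow> 'b::countable) measure set"
  assumes K: "finite K" "\<And>\<kappa>. \<kappa> \<in> K \<Longrightarrow> finite_measure \<kappa>"
    and sets_K: "\<And>\<kappa>. \<kappa> \<in> K \<Longrightarrow> sets \<kappa> = sets (PiM I (\<lambda>_. count_space UNIV))"
    and A: "A \<in> sets (PiM I (\<lambda>_. count_space UNIV))" and e: "e > 0"
  shows "\<exists>J B. finite J \<and> J \<subseteq> I \<and>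
           (\<forall>\<kappa>\<in>K. measure \<kappa> (sym_diff A {f \<in> (\<Pi>\<^sub>E i\<in>I. UNIV). restrict f J \<in> B}) < e)"
proof -
  let ?\<Omega> = "\<Pi>\<^sub>E i\<in>I. (UNIV :: 'b set)"
  let ?P = "PiM I (\<lambda>_. count_space (UNIV :: 'b set))"
  let ?R = "{{f \<in> ?\<Omega>. f i \<in> A} | i A. i \<in> I \<and> A \<in> sets (count_space (UNIV :: 'b set))}"
  define cyl where "cyl J B = {f \<in> ?\<Omega>. restrict f J \<in> B}" for J B
  have sets_P: "sets ?P = sigma_sets ?\<Omega> ?R"
    using sets_PiM_single[of I "\<lambda>_. count_space (UNIV :: 'b set)"] by simp
  have cyl: "cyl J B \<in> sets ?P" if "finite J" "J \<subseteq> I" for J B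
    unfolding cyl_def using that by (rule cylinder_in_sets_PiM)
  have "A \<in> sigma_sets ?\<Omega> ?R"
    using A sets_P by simp
  \<comment> \<open>The accuracy is quantified inside the induction, since a union needs its members
    approximated more finely.\<close>
  then have "\<forall>e>0. \<exists>J B. finite J \<and> J \<subseteq> I \<and> (\<forall>\<kappa>\<in>K. measure \<kappa> (sym_diff A (cyl J B)) < e)"
  proof (induction rule: sigma_sets.induct)
    case (Basic a)
    then obtain i A where a: "a = {f \<in> ?\<Omega>. f i \<in> A}" "i \<in> I" by blast
    have "a = cyl {i} {f. f i \<in> A}"
      unfolding a cyl_def by auto
    then have "sym_diff a (cyl {i} {f. f i \<in> A}) = {}" by blast
    then have "measure \<kappa> (sym_diff a (cyl {i} {f. f i \<in> A})) = 0" for \<kappa> :: "('i \<Rightarrow> 'b) measure"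
      by (simp only: measure_empty)
    with a(2) show ?case by (intro allI impI exI[of _ "{i}"] exI[of _ "{f. f i \<in> A}"]) simp
  next
    case Empty
    have "measure \<kappa> (sym_diff {} (cyl {} {})) = 0" for \<kappa> :: "('i \<Rightarrow> 'b) measure"
      by (simp add: cyl_def)
    then show ?case by (intro allI impI exI[of _ "{}"]) (simp del: Diff_empty empty_Diff Un_empty_left)
  next
    case (Compl a)
    have "a \<subseteq> ?\<Omega>"
      using Compl.hyps by (rule sigma_sets_into_sp[rotated]) auto
    then have "sym_diff (?\<Omega> - a) (cyl J (- B)) = sym_diff a (cyl J B)" for J B
      by (auto simp: cyl_def)
    with Compl.IH show ?case by metis
  next
    case (Union a)
    show ?case
    proof (intro allI impI)
      fix e :: real assume e: "e > 0"
      have a: "a i \<in> sets ?P" for i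
        using Union.hyps sets_P by simp
      \<comment> \<open>\<open>D n\<close> is what the first \<open>n\<close> sets leave uncovered.
        It decreases to the empty set, and as \<open>K\<close> is finite a single \<open>n\<close>
        works for all measures.\<close>
      define D where "D n = (\<Union>i. a i) - (\<Union>i<n. a i)" for n
      have "\<forall>\<^sub>F n in sequentially. \<forall>\<kappa>\<in>K. measure \<kappa> (D n) < e / 2"
      proof (intro eventually_ball_finite ballI K(1))
        fix \<kappa> assume \<kappa>: "\<kappa> \<in> K"
        interpret finite_measure \<kappa> by (rule K(2)[OF \<kappa>])
        have "(\<lambda>n. measure \<kappa> (D n)) \<longlonglongrightarrow> measure \<kappa> (\<Inter>n. D n)"
        proof (rule finite_Lim_measure_decseq)
          show "range D \<subseteq> sets \<kappa>"
            using a sets_K[OF \<kappa>] by (auto simp: D_def)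
          show "decseq D"
            by (force simp: D_def decseq_def)
        qed
        also have "(\<Inter>n. D n) = {}"
          by (auto simp: D_def)
        finally show "\<forall>\<^sub>F n in sequentially. measure \<kappa> (D n) < e / 2"
          using e by (intro order_tendstoD) auto
      qed
      then obtain n where n: "\<And>\<kappa>. \<kappa> \<in> K \<Longrightarrow> measure \<kappa> (D n) < e / 2"
        unfolding eventually_sequentially by blast
      \<comment> \<open>The \<open>n\<close> errors together stay within \<open>e / 2\<close>;
        adding 1 keeps the denominator nonzero for \<open>n\<close> = 0.\<close>
      define e' where "e' = e / (2 * (real n + 1))"
      have e': "e' > 0" using e by (simp add: e'_def)
      with Union.IH have "\<forall>i. \<exists>J B. finite J \<and> J \<subseteq> I \<and> (\<forall>\<kappa>\<in>K. measure \<kappa> (sym_diff (a i) (cyl J B)) < e')"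
        by blast
      then obtain J B where JB: "\<And>i. finite (J i)" "\<And>i. J i \<subseteq> I"
          "\<And>i \<kappa>. \<kappa> \<in> K \<Longrightarrow> measure \<kappa> (sym_diff (a i) (cyl (J i) (B i))) < e'"
        by metis
      \<comment> \<open>A finite union of cylinders is a cylinder over the union of their index
        sets.\<close>
      define J' where "J' = (\<Union>i<n. J i)"
      define B' where "B' = {f. \<exists>i<n. restrict f (J i) \<in> B i}"
      have J': "finite J'" "J' \<subseteq> I" using JB by (auto simp: J'_def)
      have "restrict (restrict f J') (J i) = restrict f (J i)" if "i < n" for f :: "'i \<Rightarrow> 'b" and i
        using that by (auto simp: J'_def restrict_def fun_eq_iff)
      then have cyl': "cyl J' B' = (\<Union>i<n. cyl (J i) (B i))"
        by (auto simp: cyl_def B'_def)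
      have "measure \<kappa> (sym_diff (\<Union>i. a i) (cyl J' B')) < e" if \<kappa>: "\<kappa> \<in> K" for \<kappa>
      proof -
        interpret finite_measure \<kappa> by (rule K(2)[OF \<kappa>])
        have m[measurable]: "a i \<in> sets \<kappa>" "cyl (J i) (B i) \<in> sets \<kappa>" "D n \<in> sets \<kappa>" for i
          using a cyl JB(1,2) unfolding sets_K[OF \<kappa>] D_def by auto
        have "measure \<kappa> (sym_diff (\<Union>i. a i) (cyl J' B'))
            \<le> measure \<kappa> (D n \<union> (\<Union>i<n. sym_diff (a i) (cyl (J i) (B i))))"
          unfolding cyl' by (intro finite_measure_mono) (auto simp: D_def)
        also have "\<dots> \<le> measure \<kappa> (D n) + measure \<kappa> (\<Union>i<n. sym_diff (a i) (cyl (J i) (B i)))"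
          by (intro measure_Un_le) auto
        also have "measure \<kappa> (\<Union>i<n. sym_diff (a i) (cyl (J i) (B i)))
            \<le> (\<Sum>i<n. measure \<kappa> (sym_diff (a i) (cyl (J i) (B i))))"
          by (intro finite_measure_subadditive_finite) auto
        also have "\<dots> \<le> (\<Sum>i<n. e')"
          using JB(3)[OF \<kappa>] by (intro sum_mono less_imp_le)
        also have "\<dots> \<le> e / 2"
          using e by (simp add: e'_def field_simps)
        finally show ?thesis using n[OF \<kappa>] by simp
      qed
      with J' show "\<exists>J B. finite J \<and> J \<subseteq> I \<and> (\<forall>\<kappa>\<in>K. measure \<kappa> (sym_diff (\<Union>i. a i) (cyl J B)) < e)"
        by blast
    qed
  qed
  with e show ?thesis unfolding cyl_def by blast
qed

section \<open>The laws of the indicator vectors as mixtures of Bernoulli products\<close>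

lemma measurable_unit_cube_component:
  assumes "p \<in> measurable M (unit_cube N)" "i \<in> idx N"
  shows "(\<lambda>\<omega>. p \<omega> i) \<in> borel_measurable M" "\<omega> \<in> space M \<Longrightarrow> p \<omega> i \<in> {0..1}"
proof -
  have "(\<lambda>\<omega>. p \<omega> i) \<in> measurable M (restrict_space borel {0..1})"
    using measurable_compose[OF assms(1) measurable_component_singleton[OF assms(2)]] by simp
  then show "(\<lambda>\<omega>. p \<omega> i) \<in> borel_measurable M" "\<omega> \<in> space M \<Longrightarrow> p \<omega> i \<in> {0..1}"
    by (auto simp: measurable_restrict_space2_iff)
qed

lemma borel_measurable_bern_wt [measurable (raw)]:
  "f \<in> borel_measurable M \<Longrightarrow> (\<lambda>\<omega>. bern_wt (f \<omega>) b) \<in> borel_measurable M"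
  by (simp add: bern_wt_def)

lemma borel_measurable_bern_mass:
  assumes "\<And>j. j \<in> J \<Longrightarrow> (\<lambda>\<omega>. p \<omega> j) \<in> borel_measurable M"
  shows "(\<lambda>\<omega>. bern_mass (p \<omega>) J B) \<in> borel_measurable M"
  unfolding bern_mass_def using assms by (intro borel_measurable_sum borel_measurable_prod borel_measurable_bern_wt)

text \<open>Integrating the conditional probability given \<open>p\<close> recovers the
  unconditional one, and conditional independence writes it almost surely as a product of Bernoulli
  weights.\<close>

lemma prob_cylinder_singleton:
  assumes "prob_space M" and p: "p \<in> measurable M (unit_cube N)"
    and X: "cond_bernoulli_vector M N p X" and J: "finite J" "J \<subseteq> idx N"
  shows "measure M {\<omega> \<in> space M. \<forall>j\<in>J. X \<omega> j = x j} = (\<integral>\<omega>. (\<Prod>j\<in>J. bern_wt (p \<omega> j) (x j)) \<partial>M)"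
\<comment> \<open>\<open>cond_indep_vars\<close> speaks of nonempty \<open>J\<close> only; for the
  empty set both sides are 1.\<close>
proof (cases "J = {}")
  case True
  interpret prob_space M by fact
  show ?thesis using True prob_space by simp
next
  case False
  interpret prob_space M by fact
  define F where "F = vimage_algebra (space M) p (unit_cube N)"
  interpret finite_measure_subalgebra M F
    by unfold_locales (auto simp: subalgebra_def F_def intro!: sets_image_in_sets[OF _ p, THEN subsetD])
  note X = X[unfolded cond_bernoulli_vector_def cond_indep_vars_def has_cond_distr_def Let_def, folded F_def]
  let ?S = "\<lambda>j. (\<lambda>\<omega>. X \<omega> j) -` {x j} \<inter> space M"
  have Xm: "(\<lambda>\<omega>. X \<omega> j) \<in> measurable M (count_space UNIV)" if "j \<in> idx N" for j
    using X that by blast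
  have S: "?S j \<in> sets M" if "j \<in> J" for j
    using Xm that J by (intro measurable_sets) auto
  have int: "integrable M (indicator (\<Inter>j\<in>J. ?S j) :: 'a \<Rightarrow> real)"
    using S J False by (intro integrable_real_indicator sets.finite_INT) (auto simp: less_top[symmetric])
  have "AE \<omega> in M. real_cond_exp M F (indicator (\<Inter>j\<in>J. ?S j)) \<omega>
      = (\<Prod>j\<in>J. cprob M F (\<lambda>\<omega>. X \<omega> j) {x j} \<omega>)"
    using X[THEN conjunct1, THEN conjunct2, rule_format, of J "\<lambda>j. {x j}"] J False by simp
  moreover have "AE \<omega> in M. \<forall>j\<in>J. cprob M F (\<lambda>\<omega>. X \<omega> j) {x j} \<omega> = bern_wt (p \<omega> j) (x j)"
  proof (intro AE_finite_allI J(1))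
    fix j assume j: "j \<in> J"
    with J have jN: "j \<in> idx N" by auto
    have "AE \<omega> in M. cprob M F (\<lambda>\<omega>. X \<omega> j) {x j} \<omega> = measure (measure_pmf (bernoulli_pmf (p \<omega> j))) {x j}"
      using X jN by simp
    then show "AE \<omega> in M. cprob M F (\<lambda>\<omega>. X \<omega> j) {x j} \<omega> = bern_wt (p \<omega> j) (x j)"
    proof (rule AE_mp, intro AE_I2 impI)
      fix \<omega> assume "\<omega> \<in> space M" and *: "cprob M F (\<lambda>\<omega>. X \<omega> j) {x j} \<omega> = measure (measure_pmf (bernoulli_pmf (p \<omega> j))) {x j}"
      \<comment> \<open>The formula for the masses of \<open>bernoulli_pmf\<close> requires a
        parameter in the unit interval.\<close>
      then have "p \<omega> j \<in> {0..1}" using measurable_unit_cube_component[OF p jN] by auto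
      then show "cprob M F (\<lambda>\<omega>. X \<omega> j) {x j} \<omega> = bern_wt (p \<omega> j) (x j)"
        unfolding * by (cases "x j") (auto simp: measure_pmf_single bern_wt_def)
    qed
  qed
  ultimately have ae: "AE \<omega> in M. real_cond_exp M F (indicator (\<Inter>j\<in>J. ?S j)) \<omega> = (\<Prod>j\<in>J. bern_wt (p \<omega> j) (x j))"
    by eventually_elim simp
  have "{\<omega> \<in> space M. \<forall>j\<in>J. X \<omega> j = x j} = (\<Inter>j\<in>J. ?S j)"
    using False by auto
  then have "measure M {\<omega> \<in> space M. \<forall>j\<in>J. X \<omega> j = x j} = (\<integral>\<omega>. indicator (\<Inter>j\<in>J. ?S j) \<omega> \<partial>M)"
    by (subst Bochner_Integration.integral_indicator) (use False in \<open>auto intro!: arg_cong[where f="measure M"]\<close>)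
  also have "\<dots> = (\<integral>\<omega>. real_cond_exp M F (indicator (\<Inter>j\<in>J. ?S j)) \<omega> \<partial>M)"
    using real_cond_exp_int(2)[OF int] by simp
  also have "\<dots> = (\<integral>\<omega>. (\<Prod>j\<in>J. bern_wt (p \<omega> j) (x j)) \<partial>M)"
    using ae measurable_unit_cube_component(1)[OF p] J
    by (intro integral_cong_AE borel_measurable_prod borel_measurable_bern_wt) auto
  finally show ?thesis .
qed

lemma prob_cylinder:
  assumes "prob_space M" and p: "p \<in> measurable M (unit_cube N)"
    and X: "cond_bernoulli_vector M N p X" and J: "finite J" "J \<subseteq> idx N"
  shows "measure M {\<omega> \<in> space M. restrict (X \<omega>) J \<in> B} = (\<integral>\<omega>. bern_mass (p \<omega>) J B \<partial>M)"
proof -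
  interpret prob_space M by fact
  let ?E = "B \<inter> (\<Pi>\<^sub>E j\<in>J. UNIV)"
  have fin: "finite ?E" using finite_PiE_bool[OF J(1)] by simp
  have Xm: "(\<lambda>\<omega>. X \<omega> j) \<in> measurable M (count_space UNIV)" if "j \<in> J" for j
    using X that J unfolding cond_bernoulli_vector_def cond_indep_vars_def Let_def by blast
  have pm: "(\<lambda>\<omega>. p \<omega> j) \<in> borel_measurable M" "\<And>\<omega>. \<omega> \<in> space M \<Longrightarrow> p \<omega> j \<in> {0..1}" if "j \<in> J" for j
    using measurable_unit_cube_component[OF p] that J by auto
  have "restrict f J \<in> B \<longleftrightarrow> (\<exists>x\<in>?E. \<forall>j\<in>J. f j = x j)" for f :: "nat \<Rightarrow> bool"
  proof
    assume "\<exists>x\<in>?E. \<forall>j\<in>J. f j = x j"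
    then obtain x where x: "x \<in> ?E" "\<forall>j\<in>J. f j = x j" by blast
    then have "restrict f J = x" by (auto simp: PiE_def extensional_def restrict_def fun_eq_iff)
    with x show "restrict f J \<in> B" by simp
  qed (auto intro!: bexI[of _ "restrict f J"])
  then have "{\<omega> \<in> space M. restrict (X \<omega>) J \<in> B} = (\<Union>x\<in>?E. {\<omega> \<in> space M. \<forall>j\<in>J. X \<omega> j = x j})"
    by auto
  also have "measure M \<dots> = (\<Sum>x\<in>?E. measure M {\<omega> \<in> space M. \<forall>j\<in>J. X \<omega> j = x j})"
  proof (rule finite_measure_finite_Union[OF fin])
    show "(\<lambda>x. {\<omega> \<in> space M. \<forall>j\<in>J. X \<omega> j = x j}) ` ?E \<subseteq> sets M"
      using Xm J(1) by (auto intro!: sets.sets_Collect_finite_All' sets.sets_Collect_finite_All)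
    show "disjoint_family_on (\<lambda>x. {\<omega> \<in> space M. \<forall>j\<in>J. X \<omega> j = x j}) ?E"
    proof (unfold disjoint_family_on_def, intro ballI impI)
      fix x y assume "x \<in> ?E" "y \<in> ?E" "x \<noteq> y"
      then obtain j where "j \<in> J" "x j \<noteq> y j" using PiE_ext[of x J _ y] by blast
      then show "{\<omega> \<in> space M. \<forall>j\<in>J. X \<omega> j = x j} \<inter> {\<omega> \<in> space M. \<forall>j\<in>J. X \<omega> j = y j} = {}"
        by auto
    qed
  qed
  also have "\<dots> = (\<Sum>x\<in>?E. \<integral>\<omega>. (\<Prod>j\<in>J. bern_wt (p \<omega> j) (x j)) \<partial>M)"
    by (intro sum.cong refl prob_cylinder_singleton[OF assms])
  also have "\<dots> = (\<integral>\<omega>. bern_mass (p \<omega>) J B \<partial>M)"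
    unfolding bern_mass_def
  proof (rule Bochner_Integration.integral_sum[symmetric])
    fix x
    have "\<bar>\<Prod>j\<in>J. bern_wt (p \<omega> j) (x j)\<bar> \<le> 1" if "\<omega> \<in> space M" for \<omega>
      unfolding abs_prod using pm(2)[OF _ that] by (intro prod_le_1) (auto simp: bern_wt_def)
    then show "integrable M (\<lambda>\<omega>. \<Prod>j\<in>J. bern_wt (p \<omega> j) (x j))"
      using pm(1) by (intro integrable_const_bound[where B=1] borel_measurable_prod borel_measurable_bern_wt AE_I2) auto
  qed
  finally show ?thesis .
qed

text \<open>For a cylinder the pointwise bound on \<open>G\<close> is integrated over the
  parameters, with the trivial bound 1 off \<open>G\<close>. Because \<open>a\<close> and
  \<open>b\<close> depend neither on \<open>J\<close> nor on \<open>B\<close>, the result passes to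
  every measurable \<open>A\<close> by approximation.\<close>

lemma prob_le_of_bern_mass_le:
  assumes "prob_space M"
    and p: "p \<in> measurable M (unit_cube N)" and p': "p' \<in> measurable M (unit_cube N)"
    and X: "X \<in> measurable M (binary_cube N)" and X': "X' \<in> measurable M (binary_cube N)"
    and X_p: "cond_bernoulli_vector M N p X" and X'_p': "cond_bernoulli_vector M N p' X'"
    and G: "G \<in> sets M" and a: "a \<ge> 0" and b: "b \<ge> 0"
    and le: "\<And>\<omega> J B. \<omega> \<in> G \<Longrightarrow> finite J \<Longrightarrow> J \<subseteq> idx N
               \<Longrightarrow> bern_mass (p \<omega>) J B \<le> a + b * bern_mass (p' \<omega>) J B"
    and A: "A \<in> sets (binary_cube N)"
  shows "measure M {\<omega> \<in> space M. X \<omega> \<in> A}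
           \<le> measure M (space M - G) + a + b * measure M {\<omega> \<in> space M. X' \<omega> \<in> A}"
proof -
  interpret prob_space M by fact
  have cyl: "measure M {\<omega> \<in> space M. restrict (X \<omega>) J \<in> B}
      \<le> measure M (space M - G) + a + b * measure M {\<omega> \<in> space M. restrict (X' \<omega>) J \<in> B}"
    if J: "finite J" "J \<subseteq> idx N" for J B
  proof -
    have m: "(\<lambda>\<omega>. bern_mass (q \<omega>) J B) \<in> borel_measurable M"
            "\<And>\<omega>. \<omega> \<in> space M \<Longrightarrow> bern_mass (q \<omega>) J B \<in> {0..1}"
      if "q \<in> measurable M (unit_cube N)" for q
      using measurable_unit_cube_component[OF that] J
      by (auto intro!: borel_measurable_bern_mass bern_mass_bounds)
    have int: "integrable M (\<lambda>\<omega>. bern_mass (q \<omega>) J B)"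
      if "q \<in> measurable M (unit_cube N)" for q
      using m[OF that] by (intro integrable_const_bound[where B=1] AE_I2) auto
    have "(\<integral>\<omega>. bern_mass (p \<omega>) J B \<partial>M)
        \<le> (\<integral>\<omega>. indicator (space M - G) \<omega> + a + b * bern_mass (p' \<omega>) J B \<partial>M)"
    proof (rule integral_mono)
      fix \<omega> assume \<omega>: "\<omega> \<in> space M"
      show "bern_mass (p \<omega>) J B \<le> indicator (space M - G) \<omega> + a + b * bern_mass (p' \<omega>) J B"
      proof (cases "\<omega> \<in> G")
        case True
        then show ?thesis using le[OF True J] by simp
      next
        case False
        then show ?thesis using m(2)[OF p \<omega>] m(2)[OF p' \<omega>] \<omega> a b
          by (simp add: add_increasing2)
      qed
    qed (use G int p p' in \<open>auto intro!: Bochner_Integration.integrable_add integrable_real_indicator simp: less_top[symmetric]\<close>)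
    also have "\<dots> = measure M (space M - G) + a + b * (\<integral>\<omega>. bern_mass (p' \<omega>) J B \<partial>M)"
      using G int[OF p'] by (simp add: prob_space less_top[symmetric])
    finally show ?thesis
      using prob_cylinder[OF assms(1) p X_p J] prob_cylinder[OF assms(1) p' X'_p' J] by simp
  qed
  show ?thesis
  proof (rule field_le_epsilon)
    fix e :: real assume e: "e > 0"
    \<comment> \<open>Replacing \<open>A\<close> by a cylinder costs \<open>d\<close> for
      \<open>X\<close> and \<open>b * d\<close> for \<open>X'\<close>, in total
      \<open>e\<close>.\<close>
    define d where "d = e / (1 + b)"
    have d: "d > 0" "d + b * d = e" using e b by (simp_all add: d_def add_divide_distrib[symmetric] distrib_left[of e, symmetric] mult.commute flip: add_divide_distrib) (simp add: divide_eq_eq algebra_simps)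
    let ?K = "{distr M (binary_cube N) X, distr M (binary_cube N) X'}"
    obtain J B where J: "finite J" "J \<subseteq> idx N" and
      K: "\<And>\<kappa>. \<kappa> \<in> ?K \<Longrightarrow> measure \<kappa> (sym_diff A {f \<in> (\<Pi>\<^sub>E i\<in>idx N. UNIV). restrict f J \<in> B}) < d"
    proof -
      have "finite_measure \<kappa>" if "\<kappa> \<in> ?K" for \<kappa>
        using that finite_measure_distr[OF X] finite_measure_distr[OF X'] by blast
      moreover have "sets \<kappa> = sets (binary_cube N)" if "\<kappa> \<in> ?K" for \<kappa>
        using that sets_distr by blast
      ultimately show thesis
        using PiM_count_space_approx[of ?K "idx N" A d] d(1) A that by blast
    qed
    define C where "C = {f \<in> (\<Pi>\<^sub>E i\<in>idx N. (UNIV :: bool set)). restrict f J \<in> B}"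
    have C: "C \<in> sets (binary_cube N)" unfolding C_def using J by (rule cylinder_in_sets_PiM)
    have diff: "\<bar>measure M {\<omega> \<in> space M. Y \<omega> \<in> A} - measure M {\<omega> \<in> space M. restrict (Y \<omega>) J \<in> B}\<bar> \<le> d"
      if Y: "Y \<in> measurable M (binary_cube N)" and YK: "distr M (binary_cube N) Y \<in> ?K" for Y
    proof -
      have YC: "{\<omega> \<in> space M. restrict (Y \<omega>) J \<in> B} = {\<omega> \<in> space M. Y \<omega> \<in> C}"
        using measurable_space[OF Y] by (auto simp: C_def space_PiM)
      have m: "{\<omega> \<in> space M. Y \<omega> \<in> A} \<in> sets M" "{\<omega> \<in> space M. Y \<omega> \<in> C} \<in> sets M"
        using measurable_sets[OF Y A] measurable_sets[OF Y C] by (simp_all add: vimage_def Int_def conj_commute)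
      have "measure M {\<omega> \<in> space M. Y \<omega> \<in> sym_diff A C} < d"
        using K[OF YK] Y A C unfolding C_def[symmetric]
        by (simp add: measure_distr vimage_def Int_def conj_commute)
      moreover have "measure M {\<omega> \<in> space M. Y \<omega> \<in> A}
          \<le> measure M {\<omega> \<in> space M. Y \<omega> \<in> C} + measure M {\<omega> \<in> space M. Y \<omega> \<in> sym_diff A C}"
        "measure M {\<omega> \<in> space M. Y \<omega> \<in> C}
          \<le> measure M {\<omega> \<in> space M. Y \<omega> \<in> A} + measure M {\<omega> \<in> space M. Y \<omega> \<in> sym_diff A C}"
      proof -
        have sd: "{\<omega> \<in> space M. Y \<omega> \<in> sym_diff A C} \<in> sets M"
        proof -
          have "{\<omega> \<in> space M. Y \<omega> \<in> sym_diff A C} = sym_diff {\<omega> \<in> space M. Y \<omega> \<in> A} {\<omega> \<in> space M. Y \<omega> \<in> C}" by auto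
          then show ?thesis using m by auto
        qed
        show "measure M {\<omega> \<in> space M. Y \<omega> \<in> A}
          \<le> measure M {\<omega> \<in> space M. Y \<omega> \<in> C} + measure M {\<omega> \<in> space M. Y \<omega> \<in> sym_diff A C}"
          by (rule order.trans[OF finite_measure_mono measure_Un_le[OF m(2) sd]]) (use m sd in auto)
        show "measure M {\<omega> \<in> space M. Y \<omega> \<in> C}
          \<le> measure M {\<omega> \<in> space M. Y \<omega> \<in> A} + measure M {\<omega> \<in> space M. Y \<omega> \<in> sym_diff A C}"
          by (rule order.trans[OF finite_measure_mono measure_Un_le[OF m(1) sd]]) (use m sd in auto)
      qed
      ultimately show ?thesis unfolding YC by linarith
    qed
    let ?P = "\<lambda>Y. measure M {\<omega> \<in> space M. restrict (Y \<omega>) J \<in> B}"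
    have "measure M {\<omega> \<in> space M. X \<omega> \<in> A} \<le> ?P X + d"
      using diff[OF X] by simp
    also have "?P X \<le> measure M (space M - G) + a + b * ?P X'"
      by (rule cyl[OF J])
    also have "b * ?P X' \<le> b * (measure M {\<omega> \<in> space M. X' \<omega> \<in> A} + d)"
    proof (intro mult_left_mono b)
      show "?P X' \<le> measure M {\<omega> \<in> space M. X' \<omega> \<in> A} + d"
        using diff[OF X'] by simp
    qed
    finally show "measure M {\<omega> \<in> space M. X \<omega> \<in> A}
        \<le> measure M (space M - G) + a + b * measure M {\<omega> \<in> space M. X' \<omega> \<in> A} + e"
      using d(2) by (simp add: algebra_simps)
  qed
qed

section \<open>Possibly infinite sums with values in \<open>ennreal\<close>\<close>

text \<open>The sum is the supremum of its finite partial sums, and a countable set has only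
  countably many finite subsets.\<close>

lemma borel_measurable_infsum_ennreal:
  fixes f :: "'i \<Rightarrow> 'a \<Rightarrow> ennreal"
  assumes "countable I" "\<And>i. i \<in> I \<Longrightarrow> f i \<in> borel_measurable M"
  shows "(\<lambda>\<omega>. \<Sum>\<^sub>\<infinity>i\<in>I. f i \<omega>) \<in> borel_measurable M"
proof -
  have "(\<lambda>\<omega>. \<Sum>\<^sub>\<infinity>i\<in>I. f i \<omega>) = (\<lambda>\<omega>. SUP F\<in>{F. finite F \<and> F \<subseteq> I}. \<Sum>i\<in>F. f i \<omega>)"
    by (intro ext nonneg_infsum_complete) auto
  also have "\<dots> \<in> borel_measurable M"
    using countable_Collect_finite_subset[OF assms(1)] assms(2)
    by (intro borel_measurable_SUP borel_measurable_sum) auto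
  finally show ?thesis .
qed

lemma sum_le_infsum_ennreal:
  fixes f :: "'i \<Rightarrow> ennreal"
  assumes "finite J" "J \<subseteq> I"
  shows "sum f J \<le> infsum f I"
  using assms by (subst nonneg_infsum_complete) (auto intro!: SUP_upper)

text \<open>This moves a condition that depends on the sample point from the index set into the
  summands, where the measurability lemma applies.\<close>

lemma infsum_filter:
  "infsum f {i \<in> I. P i} = (\<Sum>\<^sub>\<infinity>i\<in>I. if P i then f i else 0)"
  by (rule infsum_cong_neutral) auto

text \<open>This matches the union bound over bad outcomes with the two sums in the tail condition
  of (ii).\<close>

lemma sum_bad_bern_wt:
  "(\<Sum>b\<in>{b. bern_wt u b > C * bern_wt v b}. bern_wt u b)
     = (if u > C * v then u else 0) + (if 1 - u > C * (1 - v) then 1 - u else 0)"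
proof -
  have "(\<Sum>b\<in>{b. bern_wt u b > C * bern_wt v b}. bern_wt u b)
      = (\<Sum>b\<in>{b \<in> UNIV. bern_wt u b > C * bern_wt v b}. bern_wt u b)" by simp
  also have "\<dots> = (\<Sum>b\<in>UNIV. if bern_wt u b > C * bern_wt v b then bern_wt u b else 0)"
    by (rule sum.inter_filter) simp
  finally show ?thesis by (simp add: UNIV_bool bern_wt_def)
qed

section \<open>Inequalities at a fixed index, with explicit constants\<close>

text \<open>The threshold t^2 for the sum of \<open>rho\<close> balances the Hellinger bound: t^2 /
  (2 t) + 2 t = 5 t / 2.\<close>

lemma prob_le_hellinger:
  fixes p p' :: "'a \<Rightarrow> nat \<Rightarrow> real"
    and N :: enat
  defines "S \<equiv> \<lambda>\<omega>. \<Sum>\<^sub>\<infinity>i\<in>idx N. ennreal (rho (p \<omega> i) (p' \<omega> i))"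
  assumes M: "prob_space M"
    and p: "p \<in> measurable M (unit_cube N)" and p': "p' \<in> measurable M (unit_cube N)"
    and X: "X \<in> measurable M (binary_cube N)" and X': "X' \<in> measurable M (binary_cube N)"
    and X_p: "cond_bernoulli_vector M N p X" and X'_p': "cond_bernoulli_vector M N p' X'"
    and A: "A \<in> sets (binary_cube N)" and t: "t > 0"
  shows "measure M {\<omega> \<in> space M. X \<omega> \<in> A}
           \<le> measure M {\<omega> \<in> space M. S \<omega> > ennreal (t\<^sup>2)} + 5 / 2 * t + measure M {\<omega> \<in> space M. X' \<omega> \<in> A}"
proof -
  define G where "G = {\<omega> \<in> space M. S \<omega> \<le> ennreal (t\<^sup>2)}"
  note pm [measurable] = measurable_unit_cube_component(1)[OF p] measurable_unit_cube_component(1)[OF p']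
  have [measurable]: "S \<in> borel_measurable M"
    unfolding S_def rho_def by (intro borel_measurable_infsum_ennreal) auto
  have G: "G \<in> sets M" unfolding G_def by measurable
  have "space M - G = {\<omega> \<in> space M. S \<omega> > ennreal (t\<^sup>2)}"
    by (auto simp: G_def)
  moreover have "bern_mass (p \<omega>) J B \<le> 5 / 2 * t + 1 * bern_mass (p' \<omega>) J B"
    if \<omega>: "\<omega> \<in> G" and J: "finite J" "J \<subseteq> idx N" for \<omega> J B
  proof -
    have "ennreal (\<Sum>j\<in>J. rho (p \<omega> j) (p' \<omega> j)) = (\<Sum>j\<in>J. ennreal (rho (p \<omega> j) (p' \<omega> j)))"
      by (simp add: rho_nonneg sum_ennreal)
    also have "\<dots> \<le> S \<omega>"
      unfolding S_def by (rule sum_le_infsum_ennreal[OF J])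
    also have "\<dots> \<le> ennreal (t\<^sup>2)"
      using \<omega> by (simp add: G_def)
    finally have "ennreal (\<Sum>j\<in>J. rho (p \<omega> j) (p' \<omega> j)) \<le> ennreal (t\<^sup>2)" .
    then have "(\<Sum>j\<in>J. rho (p \<omega> j) (p' \<omega> j)) / (2 * t) \<le> t\<^sup>2 / (2 * t)"
      using t by (intro divide_right_mono) auto
    moreover have "t\<^sup>2 / (2 * t) = t / 2" using t by (simp add: power2_eq_square)
    moreover have "bern_mass (p \<omega>) J B
        \<le> bern_mass (p' \<omega>) J B + (\<Sum>j\<in>J. rho (p \<omega> j) (p' \<omega> j)) / (2 * t) + 2 * t"
      using \<omega> J measurable_unit_cube_component(2)[OF p] measurable_unit_cube_component(2)[OF p']
      by (intro bern_mass_le_hellinger t) (auto simp: G_def)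
    ultimately show ?thesis by simp
  qed
  ultimately show ?thesis
    using prob_le_of_bern_mass_le[OF M p p' X X' X_p X'_p' G, of "5 / 2 * t" 1] A t by simp
qed

text \<open>On the event that the sum of \<open>rho\<close> is at most \<open>K\<close> and the tail
  sum at most \<open>e\<close>, the truncated bound holds with constants that depend only on
  \<open>K\<close>, \<open>C\<close>, \<open>e\<close> and \<open>t\<close>.\<close>

lemma prob_le_tail:
  fixes p p' :: "'a \<Rightarrow> nat \<Rightarrow> real"
    and N :: enat
  defines "S \<equiv> \<lambda>\<omega>. \<Sum>\<^sub>\<infinity>i\<in>idx N. ennreal (rho (p \<omega> i) (p' \<omega> i))"
    and "T \<equiv> \<lambda>C \<omega>. (\<Sum>\<^sub>\<infinity>i\<in>{i\<in>idx N. p \<omega> i > C * p' \<omega> i}. ennreal (p \<omega> i))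
               + (\<Sum>\<^sub>\<infinity>i\<in>{i\<in>idx N. 1 - p \<omega> i > C * (1 - p' \<omega> i)}. ennreal (1 - p \<omega> i))"
  assumes M: "prob_space M"
    and p: "p \<in> measurable M (unit_cube N)" and p': "p' \<in> measurable M (unit_cube N)"
    and X: "X \<in> measurable M (binary_cube N)" and X': "X' \<in> measurable M (binary_cube N)"
    and X_p: "cond_bernoulli_vector M N p X" and X'_p': "cond_bernoulli_vector M N p' X'"
    and A: "A \<in> sets (binary_cube N)"
    and t: "t > 0" and C: "C \<ge> 1" and K: "K \<ge> 0" and e: "e \<ge> 0"
  shows "measure M {\<omega> \<in> space M. X \<omega> \<in> A}
           \<le> measure M {\<omega> \<in> space M. S \<omega> > ennreal K} + measure M {\<omega> \<in> space M. T C \<omega> > ennreal e}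
             + e + t * exp ((1 + sqrt C)\<^sup>2 * K) / 2 + measure M {\<omega> \<in> space M. X' \<omega> \<in> A} / (2 * t)"
proof -
  define G where "G = {\<omega> \<in> space M. S \<omega> \<le> ennreal K \<and> T C \<omega> \<le> ennreal e}"
  define D where "D = exp ((1 + sqrt C)\<^sup>2 * K)"
  define h where "h u v = (if u > C * v then u else 0)" for u v :: real
  note pm [measurable] = measurable_unit_cube_component(1)[OF p] measurable_unit_cube_component(1)[OF p']
  have [measurable]: "S \<in> borel_measurable M"
    unfolding S_def rho_def by (intro borel_measurable_infsum_ennreal) auto
  \<comment> \<open>With a fixed index set for all sample points, \<open>T C\<close> is seen to be
    measurable.\<close>
  have T: "T C \<omega> = (\<Sum>\<^sub>\<infinity>i\<in>idx N. ennreal (h (p \<omega> i) (p' \<omega> i)))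
      + (\<Sum>\<^sub>\<infinity>i\<in>idx N. ennreal (h (1 - p \<omega> i) (1 - p' \<omega> i)))" for \<omega>
    unfolding T_def infsum_filter h_def by (intro arg_cong2[where f="(+)"] infsum_cong) auto
  have [measurable]: "T C \<in> borel_measurable M"
    unfolding T h_def by (intro borel_measurable_add borel_measurable_infsum_ennreal) auto
  have G: "G \<in> sets M" unfolding G_def by measurable
  have "space M - G = {\<omega> \<in> space M. S \<omega> > ennreal K} \<union> {\<omega> \<in> space M. T C \<omega> > ennreal e}"
    by (auto simp: G_def)
  then have bad: "measure M (space M - G)
      \<le> measure M {\<omega> \<in> space M. S \<omega> > ennreal K} + measure M {\<omega> \<in> space M. T C \<omega> > ennreal e}"
    by (simp add: measure_Un_le)
  have "bern_mass (p \<omega>) J B \<le> (e + t * D / 2) + 1 / (2 * t) * bern_mass (p' \<omega>) J B"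
    if \<omega>: "\<omega> \<in> G" and J: "finite J" "J \<subseteq> idx N" for \<omega> J B
  proof -
    have p01: "p \<omega> j \<in> {0..1}" "p' \<omega> j \<in> {0..1}" if "j \<in> J" for j
      using \<omega> J that measurable_unit_cube_component(2)[OF p] measurable_unit_cube_component(2)[OF p']
      by (auto simp: G_def)
    then have h0: "h (p \<omega> j) (p' \<omega> j) \<ge> 0" "h (1 - p \<omega> j) (1 - p' \<omega> j) \<ge> 0" if "j \<in> J" for j
      using that by (auto simp: h_def)
    have "ennreal (\<Sum>j\<in>J. rho (p \<omega> j) (p' \<omega> j)) = (\<Sum>j\<in>J. ennreal (rho (p \<omega> j) (p' \<omega> j)))"
      by (simp add: rho_nonneg sum_ennreal)
    also have "\<dots> \<le> S \<omega>"
      unfolding S_def by (rule sum_le_infsum_ennreal[OF J])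
    also have "\<dots> \<le> ennreal K"
      using \<omega> by (simp add: G_def)
    finally have "ennreal (\<Sum>j\<in>J. rho (p \<omega> j) (p' \<omega> j)) \<le> ennreal K" .
    then have "(\<Sum>j\<in>J. rho (p \<omega> j) (p' \<omega> j)) \<le> K"
      using K by simp
    then have le_D: "exp ((1 + sqrt C)\<^sup>2 * (\<Sum>j\<in>J. rho (p \<omega> j) (p' \<omega> j))) \<le> D"
      by (simp add: D_def mult_left_mono)
    have "ennreal (\<Sum>j\<in>J. h (p \<omega> j) (p' \<omega> j) + h (1 - p \<omega> j) (1 - p' \<omega> j))
        = (\<Sum>j\<in>J. ennreal (h (p \<omega> j) (p' \<omega> j))) + (\<Sum>j\<in>J. ennreal (h (1 - p \<omega> j) (1 - p' \<omega> j)))"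
      using h0 by (simp add: sum_ennreal sum.distrib sum_nonneg)
    also have "\<dots> \<le> T C \<omega>"
      unfolding T by (intro add_mono sum_le_infsum_ennreal J)
    also have "\<dots> \<le> ennreal e"
      using \<omega> by (simp add: G_def)
    finally have "(\<Sum>j\<in>J. h (p \<omega> j) (p' \<omega> j) + h (1 - p \<omega> j) (1 - p' \<omega> j)) \<le> e"
      using e by simp
    moreover have "bern_mass (p \<omega>) J B
        \<le> (\<Sum>j\<in>J. h (p \<omega> j) (p' \<omega> j) + h (1 - p \<omega> j) (1 - p' \<omega> j))
          + (t * exp ((1 + sqrt C)\<^sup>2 * (\<Sum>j\<in>J. rho (p \<omega> j) (p' \<omega> j))) + bern_mass (p' \<omega>) J B / t) / 2"
      using bern_mass_le_tail[OF J(1) p01 C t, where B = B] unfolding sum_bad_bern_wt h_def .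
    moreover have "t * exp ((1 + sqrt C)\<^sup>2 * (\<Sum>j\<in>J. rho (p \<omega> j) (p' \<omega> j))) \<le> t * D"
      using le_D t by simp
    ultimately show ?thesis by (simp add: add_divide_distrib)
  qed
  moreover have "e + t * D / 2 \<ge> 0" using e t by (simp add: D_def)
  ultimately have "measure M {\<omega> \<in> space M. X \<omega> \<in> A}
      \<le> measure M (space M - G) + (e + t * D / 2) + 1 / (2 * t) * measure M {\<omega> \<in> space M. X' \<omega> \<in> A}"
    using t by (intro prob_le_of_bern_mass_le[OF M p p' X X' X_p X'_p' G _ _ _ A]) auto
  with bad show ?thesis
    unfolding D_def by simp
qed

section \<open>Passage to the limit\<close>

theorem theorem2p9:
  fixes M :: "nat \<Rightarrow> 'a measure"
    and N :: "nat \<Rightarrow> enat"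
    and p p' :: "nat \<Rightarrow> 'a \<Rightarrow> nat \<Rightarrow> real"
    and X X' :: "nat \<Rightarrow> 'a \<Rightarrow> nat \<Rightarrow> bool"
  assumes prob: "\<And>n. n \<ge> 1 \<Longrightarrow> prob_space (M n)"
    and N: "\<And>n. n \<ge> 1 \<Longrightarrow> N n \<ge> 1"
    and p: "\<And>n. n \<ge> 1 \<Longrightarrow> p n \<in> measurable (M n) (unit_cube (N n))"
    and p': "\<And>n. n \<ge> 1 \<Longrightarrow> p' n \<in> measurable (M n) (unit_cube (N n))"
    and X: "\<And>n. n \<ge> 1 \<Longrightarrow> X n \<in> measurable (M n) (binary_cube (N n))"
    and X': "\<And>n. n \<ge> 1 \<Longrightarrow> X' n \<in> measurable (M n) (binary_cube (N n))"
    and X_p: "\<And>n. n \<ge> 1 \<Longrightarrow> cond_bernoulli_vector (M n) (N n) (p n) (X n)"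
    and X'_p': "\<And>n. n \<ge> 1 \<Longrightarrow> cond_bernoulli_vector (M n) (N n) (p' n) (X' n)"
  shows
    "(small_o_p_1 M (\<lambda>n \<omega>. \<Sum>\<^sub>\<infinity>i\<in>idx (N n). ennreal (rho (p n \<omega> i) (p' n \<omega> i)))
        \<longrightarrow> asymp_equivalent (\<lambda>n. binary_cube (N n)) M X M X')
     \<and>
     (big_O_p_1 M (\<lambda>n \<omega>. \<Sum>\<^sub>\<infinity>i\<in>idx (N n). ennreal (rho (p n \<omega> i) (p' n \<omega> i)))
        \<and> (\<forall>\<epsilon>::real. \<epsilon> > 0 \<longrightarrow>
             ((\<lambda>C::real. limsup (\<lambda>n. ereal (measure (M n)
                 {\<omega>\<in>space (M n).
                    (\<Sum>\<^sub>\<infinity>i\<in>{i\<in>idx (N n). p n \<omega> i > C * p' n \<omega> i}. ennreal (p n \<omega> i))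
                    + (\<Sum>\<^sub>\<infinity>i\<in>{i\<in>idx (N n). 1 - p n \<omega> i > C * (1 - p' n \<omega> i)}.
                          ennreal (1 - p n \<omega> i))
                    > ennreal \<epsilon>})))
               \<longlongrightarrow> 0) at_top)
        \<longrightarrow> contiguous_wrt (\<lambda>n. binary_cube (N n)) M X M X')"
proof (intro conjI impI)
  assume S: "small_o_p_1 M (\<lambda>n \<omega>. \<Sum>\<^sub>\<infinity>i\<in>idx (N n). ennreal (rho (p n \<omega> i) (p' n \<omega> i)))"
  show "asymp_equivalent (\<lambda>n. binary_cube (N n)) M X M X'"
    unfolding asymp_equivalent_def
  proof (intro allI impI)
    fix A assume A: "\<forall>n\<ge>1. A n \<in> sets (binary_cube (N n))"
    show "(\<lambda>n. measure (M n) {\<omega> \<in> space (M n). X n \<omega> \<in> A n}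
             - measure (M n) {\<omega> \<in> space (M n). X' n \<omega> \<in> A n}) \<longlonglongrightarrow> 0"
    proof (rule tendstoI)
      fix e :: real assume e: "e > 0"
      \<comment> \<open>The error 5 t / 2 becomes \<open>e / 2\<close>, the other half being left
        for the exceptional event.\<close>
      define t where "t = e / 5"
      have t: "t > 0" using e by (simp add: t_def)
      let ?S = "\<lambda>n. measure (M n) {\<omega> \<in> space (M n).
          (\<Sum>\<^sub>\<infinity>i\<in>idx (N n). ennreal (rho (p n \<omega> i) (p' n \<omega> i))) > ennreal (t\<^sup>2)}"
      have "?S \<longlonglongrightarrow> 0"
        using S t unfolding small_o_p_1_def by simp
      then have "\<forall>\<^sub>F n in sequentially. ?S n < e / 2"
        using e by (intro order_tendstoD(2)) auto
      with eventually_ge_at_top[of 1]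
      show "\<forall>\<^sub>F n in sequentially. dist (measure (M n) {\<omega> \<in> space (M n). X n \<omega> \<in> A n}
             - measure (M n) {\<omega> \<in> space (M n). X' n \<omega> \<in> A n}) 0 < e"
      proof eventually_elim
        case (elim n)
        note n = elim(1)
        have An: "A n \<in> sets (binary_cube (N n))" using A n by blast
        \<comment> \<open>The one-sided bound is used in both directions; by the symmetry of
          \<open>rho\<close> the exceptional event is the same.\<close>
        show ?case
          using elim(2)
            prob_le_hellinger[OF prob[OF n] p[OF n] p'[OF n] X[OF n] X'[OF n] X_p[OF n] X'_p'[OF n] An t]
            prob_le_hellinger[OF prob[OF n] p'[OF n] p[OF n] X'[OF n] X[OF n] X'_p'[OF n] X_p[OF n] An t]
          unfolding rho_commute[of "p' n _ _"] by (simp add: t_def dist_real_def abs_less_iff)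
      qed
    qed
  qed
next
  let ?T = "\<lambda>C n \<omega>. (\<Sum>\<^sub>\<infinity>i\<in>{i\<in>idx (N n). p n \<omega> i > C * p' n \<omega> i}. ennreal (p n \<omega> i))
                    + (\<Sum>\<^sub>\<infinity>i\<in>{i\<in>idx (N n). 1 - p n \<omega> i > C * (1 - p' n \<omega> i)}.
                          ennreal (1 - p n \<omega> i))"
  let ?S = "\<lambda>n \<omega>. \<Sum>\<^sub>\<infinity>i\<in>idx (N n). ennreal (rho (p n \<omega> i) (p' n \<omega> i))"
  assume "big_O_p_1 M ?S
        \<and> (\<forall>\<epsilon>::real. \<epsilon> > 0 \<longrightarrow>
             ((\<lambda>C::real. limsup (\<lambda>n. ereal (measure (M n) {\<omega>\<in>space (M n). ?T C n \<omega> > ennreal \<epsilon>})))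
               \<longlongrightarrow> 0) at_top)"
  then have S: "big_O_p_1 M ?S"
    and T: "\<And>\<epsilon>::real. \<epsilon> > 0 \<Longrightarrow>
      ((\<lambda>C::real. limsup (\<lambda>n. ereal (measure (M n) {\<omega>\<in>space (M n). ?T C n \<omega> > ennreal \<epsilon>}))) \<longlongrightarrow> 0) at_top"
    by blast+
  show "contiguous_wrt (\<lambda>n. binary_cube (N n)) M X M X'"
    unfolding contiguous_wrt_def
  proof (intro allI impI)
    fix A assume A: "\<forall>n\<ge>1. A n \<in> sets (binary_cube (N n))"
      and lim: "(\<lambda>n. measure (M n) {\<omega> \<in> space (M n). X' n \<omega> \<in> A n}) \<longlonglongrightarrow> 0"
    show "(\<lambda>n. measure (M n) {\<omega> \<in> space (M n). X n \<omega> \<in> A n}) \<longlonglongrightarrow> 0"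
    proof (rule tendstoI)
      fix e0 :: real assume e0: "e0 > 0"
      \<comment> \<open>The final bound has five terms, each at most \<open>e\<close> and some
        strictly smaller.\<close>
      define e where "e = e0 / 5"
      have e: "e > 0" using e0 by (simp add: e_def)
      obtain K0 where K0: "\<And>n. n \<ge> 1 \<Longrightarrow> measure (M n) {\<omega> \<in> space (M n). ?S n \<omega> > ennreal K0} < e"
        using S e unfolding big_O_p_1_def by meson
      \<comment> \<open>\<open>prob_le_tail\<close> asks for a nonnegative level;
        \<open>ennreal\<close> sends negative numbers to 0, so the event is unchanged.\<close>
      define K where "K = max K0 0"
      have K: "K \<ge> 0" "ennreal K = ennreal K0"
        by (auto simp: K_def max_def ennreal_neg)
      have "\<forall>\<^sub>F C in at_top. limsup (\<lambda>n. ereal (measure (M n) {\<omega>\<in>space (M n). ?T C n \<omega> > ennreal e})) < ereal e"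
        using e by (intro order_tendstoD(2)[OF T[OF e]]) auto
      then obtain C where C: "C \<ge> 1"
        and C_lim: "limsup (\<lambda>n. ereal (measure (M n) {\<omega>\<in>space (M n). ?T C n \<omega> > ennreal e})) < ereal e"
        by (metis (no_types, lifting) eventually_at_top_linorder max.cobounded1 max.cobounded2)
      define D where "D = exp ((1 + sqrt C)\<^sup>2 * K)"
      \<comment> \<open>\<open>K\<close> and \<open>C\<close> are fixed first and do not depend on
        \<open>n\<close>, hence neither does \<open>t\<close>. The factor 1/(2 t) is therefore a
        constant, which the vanishing probability for \<open>X'\<close> absorbs.\<close>
      define t where "t = e / D"
      have D: "D > 0" by (simp add: D_def)
      have t: "t > 0" "t * D = e" using e D by (auto simp: t_def)
      have "\<forall>\<^sub>F n in sequentially. measure (M n) {\<omega>\<in>space (M n). ?T C n \<omega> > ennreal e} < e"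
        using Limsup_lessD[OF C_lim] by simp
      moreover have "\<forall>\<^sub>F n in sequentially. measure (M n) {\<omega> \<in> space (M n). X' n \<omega> \<in> A n} < 2 * t * e"
        using e t by (intro order_tendstoD(2)[OF lim]) auto
      ultimately show "\<forall>\<^sub>F n in sequentially. dist (measure (M n) {\<omega> \<in> space (M n). X n \<omega> \<in> A n}) 0 < e0"
        using eventually_ge_at_top[of 1]
      proof eventually_elim
        case (elim n)
        note n = elim(3)
        have An: "A n \<in> sets (binary_cube (N n))" using A n by blast
        have "measure (M n) {\<omega> \<in> space (M n). X' n \<omega> \<in> A n} / (2 * t) < e"
          using elim(2) t by (simp add: field_simps)
        then have "measure (M n) {\<omega> \<in> space (M n). X n \<omega> \<in> A n} < e0"
          using prob_le_tail[OF prob[OF n] p[OF n] p'[OF n] X[OF n] X'[OF n] X_p[OF n] X'_p'[OF n] An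
              t(1) C K(1) less_imp_le[OF e]]
            K0[OF n] elim(1) t(2) e unfolding K(2) D_def e_def by linarith
        then show ?case by simp
      qed
    qed
  qed
qed

end
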